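(* Let $(M,d)$ be a metric space, $\mu$ a $\sigma$-finite measure on the Borel $\sigma$-algebra $\mathcal{B}(M)$, and $k$ a kernel on $M$ which is a countable sum of finite kernels. For a strictly positive probability density $f:M\to(0,\infty)$ with respect to $\mu$ put $$i_{k}(f) = \int_{M} f(x)\, \Psi_{\Upsilon}^{k}(\log f)(x)\, \mathrm{d}\mu(x)\in[0,\infty],$$ and for a strictly positive probability density $F:M\times M\to(0,\infty)$ with respect to $\mu\otimes\mu$ put $$i_{k \oplus k}(F)=\int_{M\times M}F(x,y)\,\Psi_\Upsilon^{k\oplus k}(\log F)(x,y)\,\mathrm{d}(\mu\otimes\mu)(x,y)\in[0,\infty].$$ Then $i_{k\oplus k}$ is a lifting of $i_k$.
   Context: Kernels. A kernel on a metric space $(M,d)$ is a map $k:M\times\mathcal{B}(M)\to[0,\infty]$ such that $x\mapsto k(x,A)$ is Borel measurable for every $A\in\mathcal{B}(M)$, and $k(x,\cdot)$ is a $\sigma$-finite measure for every $x\in M$. A kernel is finite if $k(x,\cdot)$ is a finite measure for every $x\in M$. Products. $M\times M$ carries the metric $((x,y),(u,v))\mapsto d(x,u)+d(y,v)$, and it is always assumed that $\mathcal{B}(M\times M)=\mathcal{B}(M)\otimes\mathcal{B}(M)$. Tensorization. For kernels $k_i$ on metric spaces $M_i$ ($i=1,2$), $$(k_1\oplus k_2)((x,y),A):=k_1(x,A^y)+k_2(y,A_x),\quad (x,y)\in M_1\times M_2,\ A\in\mathcal{B}(M_1)\otimes\mathcal{B}(M_2),$$ where $A_x=\{y\in M_2:(x,y)\in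 A\}$ and $A^y=\{x\in M_1:(x,y)\in A\}$. (If $k_1,k_2$ are countable sums of finite kernels, this is a kernel on $M_1\times M_2$.) The operator $\Psi_\Upsilon$. Let $\Upsilon(r)=e^r-1-r\ge 0$, $r\in\mathbb{R}$. For a kernel $k$ on a metric space $N$ and measurable $g:N\to\mathbb{R}$, $$\Psi_\Upsilon^k(g)(x)=\int_{N\setminus\{x\}}\Upsilon(g(y)-g(x))\,k(x,\mathrm{d}y)\in[0,\infty],\quad x\in N.$$ This is used with $N=M$ and kernel $k$, and with $N=M\times M$ and kernel $k\oplus k$. When the kernel is a countable sum of finite kernels, $\Psi_\Upsilon^k(g)$ is measurable. Lifting. For symmetric $F:M\times M\to\mathbb{R}$ (i.e. $F(x,y)=F(y,x)$), write $\Pi_\mu F(x)=\int_M F(x,y)\,\mathrm{d}\mu(y)$; for $f:M\to\mathbb{R}$ write $(f\otimes f)(x,y)=f(x)f(y)$. Let $j$ be a functional defined on a subset $D(j)$ of the probability densities on $M$ with respect to $\mu$, and $J$ a functional defined on a subset $D(J)$ of the probability densities on $M\times M$ with respect to $\mu\otimes\mu$. $J$ is called a lifting of $j$ if: (i) for every $f\in D(j)$ with $f\otimes f\in D(J)$, $J(f\otimes f)=2j(f)$; (ii) for every symmetric $F\in D(J)$ with $\Pi_\mu F\in D(j)$, $J(F)\ge 2j(\Pi_\mu F)$. Here $D(i_k)$ is the set of measurable $f:M\to(0,\infty)$ with $\int_M f\,\mathrm{d}\mu=1$, and $D(i_{k\oplus k})$ is the set of measurable $F:M\times M\to(0,\infty)$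 with $\int F\,\mathrm{d}(\mu\otimes\mu)=1$; the functionals take values in $[0,\infty]$. *)

theory Defs
  imports "HOL-Analysis.Analysis"
begin

definition is_kernel :: "('a::metric_space \<Rightarrow> 'a measure) \<Rightarrow> bool" where
  "is_kernel k \<longleftrightarrow>
     (\<forall>x. sets (k x) = sets borel \<and> sigma_finite_measure (k x)) \<and>
     (\<forall>A\<in>sets borel. (\<lambda>x. emeasure (k x) A) \<in> borel_measurable borel)"

definition is_finite_kernel :: "('a::metric_space \<Rightarrow> 'a measure) \<Rightarrow> bool" where
  "is_finite_kernel k \<longleftrightarrow> is_kernel k \<and> (\<forall>x. finite_measure (k x))"

text \<open>Finite sums are included, since the remaining summands may be zero kernels.\<close>

definition countable_sum_of_finite_kernels :: "('a::metric_space \<Rightarrow> 'a measure) \<Rightarrow> bool" where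
  "countable_sum_of_finite_kernels k \<longleftrightarrow>
     (\<exists>kn :: nat \<Rightarrow> 'a \<Rightarrow> 'a measure.
        (\<forall>n. is_finite_kernel (kn n)) \<and>
        (\<forall>x. \<forall>A\<in>sets borel. emeasure (k x) A = (\<Sum>n. emeasure (kn n x) A)))"

text \<open>The set function below is countably additive whenever each \<open>k\<^sub>i x\<close> is a Borel measure,
  so that \<open>measure_of\<close> does not fall back to its default value; see \<open>emeasure_kernel_tensor\<close>.\<close>

definition kernel_tensor ::
  "('a::metric_space \<Rightarrow> 'a measure) \<Rightarrow> ('b::metric_space \<Rightarrow> 'b measure)
     \<Rightarrow> 'a \<times> 'b \<Rightarrow> ('a \<times> 'b) measure"  (infixl "\<oplus>\<^sub>k" 65) where
  "k1 \<oplus>\<^sub>k k2 = (\<lambda>(x, y). measure_of UNIV (sets (borel \<Otimes>\<^sub>M borel))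
     (\<lambda>A. emeasure (k1 x) {u. (u, y) \<in> A} + emeasure (k2 y) {v. (x, v) \<in> A}))"

lemma sets_kernel_tensor [simp, measurable_cong]:
  "sets ((k1 \<oplus>\<^sub>k k2) p) = sets (borel \<Otimes>\<^sub>M borel)"
proof -
  have "sigma_algebra UNIV (sets (borel \<Otimes>\<^sub>M borel :: ('a \<times> 'b) measure))"
    using sets.sigma_algebra_axioms[of "borel \<Otimes>\<^sub>M borel :: ('a \<times> 'b) measure"]
    by (simp add: space_pair_measure)
  then show ?thesis
    by (cases p) (simp add: kernel_tensor_def sigma_algebra.sigma_sets_eq)
qed

lemma space_kernel_tensor [simp]: "space ((k1 \<oplus>\<^sub>k k2) p) = UNIV"
  using sets_eq_imp_space_eq[OF sets_kernel_tensor[of k1 k2 p]]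
  by (simp add: space_pair_measure)

lemma emeasure_kernel_tensor:
  fixes x :: "'a::metric_space" and y :: "'b::metric_space"
  assumes k1: "sets (k1 x) = sets borel" and k2: "sets (k2 y) = sets borel"
    and A: "A \<in> sets (borel \<Otimes>\<^sub>M borel)"
  shows "emeasure ((k1 \<oplus>\<^sub>k k2) (x, y)) A
    = emeasure (k1 x) {u. (u, y) \<in> A} + emeasure (k2 y) {v. (x, v) \<in> A}"
proof -
  let ?B = "borel \<Otimes>\<^sub>M borel :: ('a \<times> 'b) measure"
  have s1: "{u. (u, y) \<in> B} \<in> sets (k1 x)" if "B \<in> sets ?B" for B
    using sets_Pair2[OF that, of y] by (simp add: k1 vimage_def)
  have s2: "{v. (x, v) \<in> B} \<in> sets (k2 y)" if "B \<in> sets ?B" for B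
    using sets_Pair1[OF that, of x] by (simp add: k2 vimage_def)
  show ?thesis
  proof (rule emeasure_measure_of[where \<Omega>=UNIV and A="sets ?B"])
    show "(k1 \<oplus>\<^sub>k k2) (x, y) = measure_of UNIV (sets ?B)
      (\<lambda>A. emeasure (k1 x) {u. (u, y) \<in> A} + emeasure (k2 y) {v. (x, v) \<in> A})"
      by (simp add: kernel_tensor_def)
    show "countably_additive (sets ((k1 \<oplus>\<^sub>k k2) (x, y)))
      (\<lambda>A. emeasure (k1 x) {u. (u, y) \<in> A} + emeasure (k2 y) {v. (x, v) \<in> A})"
    proof (rule countably_additiveI)
      fix B :: "nat \<Rightarrow> ('a \<times> 'b) set"
      assume rB: "range B \<subseteq> sets ((k1 \<oplus>\<^sub>k k2) (x, y))" and dB: "disjoint_family B"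
      have B: "B n \<in> sets ?B" for n using rB by auto
      have "(\<Sum>n. emeasure (k1 x) {u. (u, y) \<in> B n}) = emeasure (k1 x) (\<Union>n. {u. (u, y) \<in> B n})"
        using dB s1[OF B] by (intro suminf_emeasure) (auto simp: disjoint_family_on_def)
      moreover have "(\<Sum>n. emeasure (k2 y) {v. (x, v) \<in> B n}) = emeasure (k2 y) (\<Union>n. {v. (x, v) \<in> B n})"
        using dB s2[OF B] by (intro suminf_emeasure) (auto simp: disjoint_family_on_def)
      moreover have "(\<Union>n. {u. (u, y) \<in> B n}) = {u. (u, y) \<in> \<Union> (range B)}"
        "(\<Union>n. {v. (x, v) \<in> B n}) = {v. (x, v) \<in> \<Union> (range B)}" by auto
      ultimately show "(\<Sum>n. emeasure (k1 x) {u. (u, y) \<in> B n} + emeasure (k2 y) {v. (x, v) \<in> B n})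
        = emeasure (k1 x) {u. (u, y) \<in> \<Union> (range B)} + emeasure (k2 y) {v. (x, v) \<in> \<Union> (range B)}"
        by (simp add: suminf_add[symmetric] summableI)
    qed
  qed (use A in \<open>auto simp: positive_def\<close>)
qed

definition Upsilon :: "real \<Rightarrow> real" where
  "Upsilon r = exp r - 1 - r"

definition Psi_Upsilon :: "('n \<Rightarrow> 'n measure) \<Rightarrow> ('n \<Rightarrow> real) \<Rightarrow> 'n \<Rightarrow> ennreal" where
  "Psi_Upsilon k g x = (\<integral>\<^sup>+y\<in>UNIV - {x}. ennreal (Upsilon (g y - g x)) \<partial>k x)"

definition prob_densities :: "'n measure \<Rightarrow> ('n \<Rightarrow> real) set" where
  "prob_densities \<nu> = {f \<in> borel_measurable \<nu>.
     (\<forall>x\<in>space \<nu>. 0 \<le> f x) \<and> (\<integral>\<^sup>+x. ennreal (f x) \<partial>\<nu>) = 1}"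

definition pos_prob_densities :: "'n measure \<Rightarrow> ('n \<Rightarrow> real) set" where
  "pos_prob_densities \<nu> = {f \<in> borel_measurable \<nu>.
     (\<forall>x\<in>space \<nu>. 0 < f x) \<and> (\<integral>\<^sup>+x. ennreal (f x) \<partial>\<nu>) = 1}"

text \<open>Both \<open>i\<^sub>k\<close> (with \<open>\<nu> = \<mu>\<close>) and its counterpart on the product (with \<open>\<nu> = \<mu> \<Otimes>\<^sub>M \<mu>\<close> and the
  kernel \<open>k \<oplus>\<^sub>k k\<close>) are instances of the following functional, with domain
  \<open>pos_prob_densities \<nu>\<close>.\<close>

definition info_functional :: "'n measure \<Rightarrow> ('n \<Rightarrow> 'n measure) \<Rightarrow> ('n \<Rightarrow> real) \<Rightarrow> ennreal" where
  "info_functional \<nu> k f = (\<integral>\<^sup>+x. ennreal (f x) * Psi_Upsilon k (\<lambda>y. ln (f y)) x \<partial>\<nu>)"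

definition symmetric_fun :: "('a \<times> 'a \<Rightarrow> real) \<Rightarrow> bool" where
  "symmetric_fun F \<longleftrightarrow> (\<forall>x y. F (x, y) = F (y, x))"

text \<open>For nonnegative \<open>F\<close> the Bochner integral is \<open>0\<close> wherever the marginal is infinite, so a
  marginal that is infinite somewhere is never a strictly positive density.\<close>

definition marginal :: "'a measure \<Rightarrow> ('a \<times> 'a \<Rightarrow> real) \<Rightarrow> 'a \<Rightarrow> real" where
  "marginal \<mu> F x = (\<integral>y. F (x, y) \<partial>\<mu>)"

definition fun_tensor :: "('a \<Rightarrow> real) \<Rightarrow> ('a \<Rightarrow> real) \<Rightarrow> 'a \<times> 'a \<Rightarrow> real" where
  "fun_tensor f g = (\<lambda>(x, y). f x * g y)"

text \<open>A functional is given by its domain together with a total function, whose values outside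
  the domain are irrelevant.\<close>

definition is_lifting ::
  "'a measure \<Rightarrow> ('a \<times> 'a \<Rightarrow> real) set \<Rightarrow> (('a \<times> 'a \<Rightarrow> real) \<Rightarrow> ennreal)
     \<Rightarrow> ('a \<Rightarrow> real) set \<Rightarrow> (('a \<Rightarrow> real) \<Rightarrow> ennreal) \<Rightarrow> bool" where
  "is_lifting \<mu> DJ J Dj j \<longleftrightarrow>
     Dj \<subseteq> prob_densities \<mu> \<and> DJ \<subseteq> prob_densities (\<mu> \<Otimes>\<^sub>M \<mu>) \<and>
     (\<forall>f\<in>Dj. fun_tensor f f \<in> DJ \<longrightarrow> J (fun_tensor f f) = 2 * j f) \<and>
     (\<forall>F\<in>DJ. symmetric_fun F \<longrightarrow> marginal \<mu> F \<in> Dj \<longrightarrow> J F \<ge> 2 * j (marginal \<mu> F))"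

end

theory Submission
  imports Defs
begin

text \<open>
  Write \<open>G a b = a * Upsilon (ln b - ln a) = b - a - a * ln (b / a)\<close> for \<open>a, b > 0\<close>. Moving the
  factor \<open>f x\<close> into the inner integral turns the functional of \<open>k\<close> into the integral of
  \<open>G (f x) (f u)\<close> over all jumps from \<open>x\<close> to \<open>u\<close>. The function \<open>G\<close> is nonnegative, homogeneous of
  degree one and convex, being the perspective of \<open>t - 1 - ln t\<close>, and these properties carry the
  whole proof.

  The tensorized kernel moves one coordinate at a time, so the functional of \<open>F\<close> is a sum of two
  terms, one for each coordinate. If \<open>F\<close> is symmetric, the two terms agree. In the first one the
  coordinate \<open>y\<close> stays fixed during the jump, and Tonelli's theorem allows integrating it out
  before the jump (\<open>info_functional_symmetric\<close>): the functional of \<open>F\<close> is twice the integral over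
  the jumps from \<open>x\<close> to \<open>u\<close> of \<open>\<integral>\<^sup>+y. G (F (x, y)) (F (u, y)) \<partial>\<mu>\<close>. Both lifting properties now
  follow by comparing this inner integral with the jump cost of the marginal.

  \<^item> If \<open>F = f \<otimes> f\<close>, homogeneity makes it equal to \<open>G (f x) (f u)\<close>, because \<open>f\<close> has total mass one.

  \<^item> For general symmetric \<open>F\<close>, Jensen's inequality for \<open>G\<close> (\<open>jump_cost_Jensen\<close>) bounds it from
    below by the value of \<open>G\<close> at the two marginals.

  Tonelli's theorem needs joint measurability of kernel integrals with parameters, and this is
  where the decomposition into finite kernels enters (\<open>measurable_nn_integral_kernel\<close>).
\<close>

section \<open>The jump cost\<close>

definition jump_cost :: "real \<Rightarrow> real \<Rightarrow> real" where
  "jump_cost a b = a * Upsilon (ln b - ln a)"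

lemma Upsilon_nonneg: "0 \<le> Upsilon r"
  unfolding Upsilon_def using exp_ge_add_one_self[of r] by linarith

lemma borel_measurable_Upsilon [measurable]: "Upsilon \<in> borel_measurable borel"
  unfolding Upsilon_def[abs_def] by measurable

lemma borel_measurable_jump_cost [measurable (raw)]:
  assumes [measurable]: "f \<in> borel_measurable N" "g \<in> borel_measurable N"
  shows "(\<lambda>x. jump_cost (f x) (g x)) \<in> borel_measurable N"
  unfolding jump_cost_def by measurable

lemma jump_cost_nonneg: "0 < a \<Longrightarrow> 0 \<le> jump_cost a b"
  by (simp add: jump_cost_def Upsilon_nonneg)

lemma jump_cost_homogeneous:
  assumes "0 < c" "0 < a" "0 < b"
  shows "jump_cost (a * c) (b * c) = c * jump_cost a b"
  using assms by (simp add: jump_cost_def ln_mult)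

lemma jump_cost_eq:
  assumes "0 < a" "0 < b"
  shows "jump_cost a b = b - a - a * (ln b - ln a)"
  using assms by (simp add: jump_cost_def Upsilon_def exp_diff field_simps)

text \<open>
  The left-hand side is the tangent plane of the jump cost at \<open>(A, B)\<close>. It passes through the
  origin because the jump cost is homogeneous of degree one. The gap between cost and plane is
  again a jump cost, namely from \<open>a\<close> to the point \<open>b * A / B\<close>, and hence nonnegative.
\<close>

lemma jump_cost_tangent:
  assumes "0 < a" "0 < b" "0 < A" "0 < B"
  shows "(1 - A / B) * b - (ln B - ln A) * a \<le> jump_cost a b"
proof -
  have "0 \<le> jump_cost a (b * A / B)"
    using assms by (intro jump_cost_nonneg)
  also have "\<dots> = jump_cost a b - ((1 - A / B) * b - (ln B - ln A) * a)"
    using assms by (simp add: jump_cost_eq ln_mult ln_div algebra_simps)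
  finally show ?thesis by simp
qed

text \<open>
  Integrating the tangent plane at the pair of integrals gives the claim. As the plane has no
  constant term, the measure may be infinite, unlike in Jensen's inequality for a general
  convex function.
\<close>

lemma jump_cost_Jensen:
  assumes a: "integrable \<mu> a" "\<And>y. y \<in> space \<mu> \<Longrightarrow> 0 < a y" "0 < (\<integral>y. a y \<partial>\<mu>)"
    and b: "integrable \<mu> b" "\<And>y. y \<in> space \<mu> \<Longrightarrow> 0 < b y" "0 < (\<integral>y. b y \<partial>\<mu>)"
  shows "ennreal (jump_cost (\<integral>y. a y \<partial>\<mu>) (\<integral>y. b y \<partial>\<mu>)) \<le> (\<integral>\<^sup>+y. ennreal (jump_cost (a y) (b y)) \<partial>\<mu>)"
proof (cases "integrable \<mu> (\<lambda>y. jump_cost (a y) (b y))")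
  case True
  let ?A = "\<integral>y. a y \<partial>\<mu>" and ?B = "\<integral>y. b y \<partial>\<mu>"
  have "jump_cost ?A ?B = (1 - ?A / ?B) * ?B - (ln ?B - ln ?A) * ?A"
    using a(3) b(3) by (simp add: jump_cost_eq field_simps)
  also have "\<dots> = (\<integral>y. (1 - ?A / ?B) * b y - (ln ?B - ln ?A) * a y \<partial>\<mu>)"
    using a(1) b(1) by simp
  also have "\<dots> \<le> (\<integral>y. jump_cost (a y) (b y) \<partial>\<mu>)"
    using a b True by (intro integral_mono) (auto intro!: jump_cost_tangent)
  finally have "ennreal (jump_cost ?A ?B) \<le> ennreal (\<integral>y. jump_cost (a y) (b y) \<partial>\<mu>)"
    by (rule ennreal_leI)
  also have "\<dots> = (\<integral>\<^sup>+y. ennreal (jump_cost (a y) (b y)) \<partial>\<mu>)"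
    using True a(2) by (intro nn_integral_eq_integral[symmetric]) (auto simp: jump_cost_nonneg)
  finally show ?thesis .
next
  case False
  have [measurable]: "a \<in> borel_measurable \<mu>" "b \<in> borel_measurable \<mu>"
    using a(1) b(1) by auto
  have "AE y in \<mu>. 0 \<le> jump_cost (a y) (b y)"
    using a(2) by (auto simp: jump_cost_nonneg)
  then have "\<not> (\<integral>\<^sup>+y. ennreal (jump_cost (a y) (b y)) \<partial>\<mu>) < \<infinity>"
    using False integrableI_nonneg[of "\<lambda>y. jump_cost (a y) (b y)" \<mu>] borel_measurable_jump_cost[of a \<mu> b]
      borel_measurable_integrable[OF a(1)] borel_measurable_integrable[OF b(1)]
    by blast
  then show ?thesis by (simp add: not_less top_unique)
qed

section \<open>Integration against kernels\<close>

text \<open>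
  The point \<open>x\<close> may be put back into the domain of integration, since the integrand vanishes
  there even when the kernel charges \<open>{x}\<close>.
\<close>

lemma Psi_Upsilon_eq:
  "Psi_Upsilon k g x = (\<integral>\<^sup>+y. ennreal (Upsilon (g y - g x)) \<partial>k x)"
  unfolding Psi_Upsilon_def
  by (intro nn_integral_cong) (auto simp: indicator_def Upsilon_def)

lemma times_Psi_Upsilon_ln:
  assumes k: "sets (k x) = sets N" and f [measurable]: "f \<in> borel_measurable N" and pos: "0 < f x"
  shows "ennreal (f x) * Psi_Upsilon k (\<lambda>y. ln (f y)) x
    = (\<integral>\<^sup>+y. ennreal (jump_cost (f x) (f y)) \<partial>k x)"
proof -
  note [measurable_cong] = k
  show ?thesis
    using pos by (simp add: Psi_Upsilon_eq nn_integral_cmult[symmetric] jump_cost_def ennreal_mult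
        Upsilon_nonneg)
qed

lemma nn_integral_kernel_tensor:
  fixes x :: "'a::metric_space" and y :: "'b::metric_space"
  assumes k1: "sets (k1 x) = sets borel" and k2: "sets (k2 y) = sets borel"
    and h: "h \<in> borel_measurable (borel \<Otimes>\<^sub>M borel)"
  shows "(\<integral>\<^sup>+p. h p \<partial>(k1 \<oplus>\<^sub>k k2) (x, y)) = (\<integral>\<^sup>+u. h (u, y) \<partial>k1 x) + (\<integral>\<^sup>+v. h (x, v) \<partial>k2 y)"
proof -
  note [measurable_cong] = k1 k2
  show ?thesis
    using h
  proof (induction rule: borel_measurable_induct)
    case (cong f g)
    then show ?case by (simp add: space_pair_measure)
  next
    case (set A)
    then have [measurable]: "A \<in> sets (borel \<Otimes>\<^sub>M borel)" .
    have "{u. (u, y) \<in> A} \<in> sets (k1 x)" "{v. (x, v) \<in> A} \<in> sets (k2 y)"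
      using sets_Pair2[OF set, of y] sets_Pair1[OF set, of x] by (simp_all add: k1 k2 vimage_def)
    moreover have "(\<lambda>u. indicator A (u, y)) = (indicator {u. (u, y) \<in> A} :: 'a \<Rightarrow> ennreal)"
      "(\<lambda>v. indicator A (x, v)) = (indicator {v. (x, v) \<in> A} :: 'b \<Rightarrow> ennreal)"
      by (auto simp: indicator_def)
    ultimately show ?case
      using set by (simp add: emeasure_kernel_tensor k1 k2)
  next
    case (mult f c)
    note [measurable] = mult(2)
    show ?case
      using mult by (simp add: nn_integral_cmult distrib_left)
  next
    case (add f g)
    note [measurable] = add(1,4)
    show ?case
      using add by (simp add: nn_integral_add ac_simps)
  next
    case (seq U)
    note [measurable] = seq(1)
    have sections: "incseq (\<lambda>i u. U i (u, y))" "incseq (\<lambda>i v. U i (x, v))"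
      using seq(3) by (auto simp: incseq_def le_fun_def)
    have "(\<integral>\<^sup>+p. Sup (range U) p \<partial>(k1 \<oplus>\<^sub>k k2) (x, y)) = (SUP i. \<integral>\<^sup>+p. U i p \<partial>(k1 \<oplus>\<^sub>k k2) (x, y))"
      using seq(3) by (simp add: image_comp nn_integral_monotone_convergence_SUP)
    also have "\<dots> = (SUP i. (\<integral>\<^sup>+u. U i (u, y) \<partial>k1 x) + (\<integral>\<^sup>+v. U i (x, v) \<partial>k2 y))"
      by (simp only: seq.IH)
    also have "\<dots> = (SUP i. \<integral>\<^sup>+u. U i (u, y) \<partial>k1 x) + (SUP i. \<integral>\<^sup>+v. U i (x, v) \<partial>k2 y)"
      using sections by (intro ennreal_SUP_add incseq_nn_integral)
    also have "\<dots> = (\<integral>\<^sup>+u. Sup (range U) (u, y) \<partial>k1 x) + (\<integral>\<^sup>+v. Sup (range U) (x, v) \<partial>k2 y)"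
      using sections by (simp add: image_comp nn_integral_monotone_convergence_SUP)
    finally show ?case using seq(4) by simp
  qed
qed

text \<open>
  The argument is Dynkin's: the sets \<open>A\<close> with the claimed property contain the rectangles and are
  closed under disjoint unions. Finiteness of the kernel makes them closed under complements,
  where the measure of a section is subtracted from the total mass.
\<close>

lemma measurable_emeasure_finite_kernel_section:
  fixes k :: "'a::metric_space \<Rightarrow> 'a measure"
  assumes k: "is_finite_kernel k" and g [measurable]: "g \<in> N \<rightarrow>\<^sub>M borel"
    and A: "A \<in> sets (N \<Otimes>\<^sub>M borel)"
  shows "(\<lambda>p. emeasure (k (g p)) (Pair p -` A)) \<in> borel_measurable N"
proof -
  have sets: "sets (k x) = sets borel" and fin: "finite_measure (k x)" for x
    using k by (auto simp: is_finite_kernel_def is_kernel_def)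
  have meas [measurable]: "(\<lambda>x. emeasure (k x) B) \<in> borel_measurable borel" if "B \<in> sets borel" for B
    using k that by (auto simp: is_finite_kernel_def is_kernel_def)
  have sp: "space (k x) = UNIV" for x
    using sets_eq_imp_space_eq[OF sets] by simp
  have Pair: "Pair p -` B \<in> sets (k (g p))" if "B \<in> sets (N \<Otimes>\<^sub>M borel)" for B p
    using sets_Pair1[OF that] by (simp add: sets)
  show ?thesis
    using A unfolding sets_pair_measure
  proof (induction rule: sigma_sets_induct_disjoint[OF Int_stable_pair_measure_generator pair_measure_closed,
        consumes 1, case_names basic empty compl union])
    case (basic A)
    then obtain B C where [measurable]: "B \<in> sets N" "C \<in> sets borel" and A: "A = B \<times> C"
      by auto
    have "(\<lambda>p. emeasure (k (g p)) (Pair p -` A)) = (\<lambda>p. indicator B p * emeasure (k (g p)) C)"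
      by (auto simp: A indicator_def fun_eq_iff)
    then show ?case by simp
  next
    case empty
    then show ?case by simp
  next
    case (compl A)
    then have A: "A \<in> sets (N \<Otimes>\<^sub>M borel)" by (simp add: sets_pair_measure)
    note [measurable] = compl(2)
    have "emeasure (k (g p)) (Pair p -` (space N \<times> space borel - A))
      = emeasure (k (g p)) UNIV - emeasure (k (g p)) (Pair p -` A)" if "p \<in> space N" for p
    proof -
      have "Pair p -` (space N \<times> space borel - A) = space (k (g p)) - Pair p -` A"
        using that by (auto simp: sp)
      then show ?thesis
        using emeasure_compl[OF Pair[OF A, of p]] finite_measure.emeasure_finite[OF fin, of "g p"]
        by (simp add: sp)
    qed
    then show ?case
      by (simp cong: measurable_cong)
  next
    case (union F)
    then have F: "F n \<in> sets (N \<Otimes>\<^sub>M borel)" for n by (auto simp: sets_pair_measure)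
    note [measurable] = union(3)
    have "(\<lambda>p. emeasure (k (g p)) (Pair p -` (\<Union>n. F n))) = (\<lambda>p. \<Sum>n. emeasure (k (g p)) (Pair p -` F n))"
      unfolding vimage_UN
      using union(1) Pair[OF F]
      by (intro ext suminf_emeasure[symmetric]) (auto simp: disjoint_family_on_def)
    then show ?case by simp
  qed
qed

text \<open>
  The map \<open>g\<close> selects the part of the parameter that the kernel sees; the integrand may depend on
  all of it. Below, \<open>p = (x, y)\<close> and the kernel sees only \<open>x\<close>. For indicator functions the claim
  is summed up from the finite kernels; from there on, only the full kernel is integrated against.
\<close>

lemma measurable_nn_integral_kernel:
  fixes k :: "'a::metric_space \<Rightarrow> 'a measure"
  assumes k: "is_kernel k" and sum: "countable_sum_of_finite_kernels k"
    and g [measurable]: "g \<in> N \<rightarrow>\<^sub>M borel"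
    and h: "h \<in> borel_measurable (N \<Otimes>\<^sub>M borel)"
  shows "(\<lambda>p. \<integral>\<^sup>+u. h (p, u) \<partial>k (g p)) \<in> borel_measurable N"
proof -
  have sets [measurable_cong]: "sets (k x) = sets borel" for x
    using k by (auto simp: is_kernel_def)
  obtain kn :: "nat \<Rightarrow> 'a \<Rightarrow> 'a measure" where
    kn: "\<And>n. is_finite_kernel (kn n)"
      "\<And>x A. A \<in> sets borel \<Longrightarrow> emeasure (k x) A = (\<Sum>n. emeasure (kn n x) A)"
    using sum by (auto simp: countable_sum_of_finite_kernels_def)
  show ?thesis
    using h
  proof (induction rule: borel_measurable_induct)
    case (cong f g)
    then show ?case
      by (simp add: space_pair_measure cong: measurable_cong)
  next
    case (set A)
    have S: "Pair p -` A \<in> sets borel" for p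
      using sets_Pair1[OF set] by simp
    note [measurable] = measurable_emeasure_finite_kernel_section[OF kn(1) g set]
    have "(\<integral>\<^sup>+u. indicator A (p, u) \<partial>k (g p)) = (\<Sum>n. emeasure (kn n (g p)) (Pair p -` A))" for p
    proof -
      have "(\<lambda>u. indicator A (p, u)) = (indicator (Pair p -` A) :: 'a \<Rightarrow> ennreal)"
        by (auto simp: indicator_def)
      then show ?thesis
        using S by (simp add: sets kn(2))
    qed
    then show ?case by simp
  next
    case (mult f c)
    note [measurable] = mult(2,4)
    have "(\<lambda>u. f (p, u)) \<in> borel_measurable (k (g p))" if "p \<in> space N" for p
      using that by measurable
    then show ?case
      by (simp add: nn_integral_cmult cong: measurable_cong)
  next
    case (add f f')
    note [measurable] = add(1,3,4,6,7)
    have "(\<lambda>u. f (p, u)) \<in> borel_measurable (k (g p))" "(\<lambda>u. f' (p, u)) \<in> borel_measurable (k (g p))"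
      if "p \<in> space N" for p
      using that by measurable
    then show ?case
      by (simp add: nn_integral_add cong: measurable_cong)
  next
    case (seq U)
    note [measurable] = seq(1,5)
    have i: "incseq (\<lambda>i u. U i (p, u))" for p
      using seq(3) by (auto simp: incseq_def le_fun_def)
    have "(\<lambda>u. U i (p, u)) \<in> borel_measurable (k (g p))" if "p \<in> space N" for p i
      using that by measurable
    then have "(\<integral>\<^sup>+u. (SUP i. U i) (p, u) \<partial>k (g p)) = (SUP i. \<integral>\<^sup>+u. U i (p, u) \<partial>k (g p))"
      if "p \<in> space N" for p
      using that by (simp add: image_comp nn_integral_monotone_convergence_SUP[OF i])
    then show ?case
      by (simp cong: measurable_cong)
  qed
qed

section \<open>The product functional on symmetric densities\<close>

text \<open>
  In the iterated integral, \<open>(x, u)\<close> is a jump of the first coordinate and \<open>y\<close> is the coordinate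
  that does not move. Jumps of the second coordinate account for the factor two.
\<close>

lemma info_functional_symmetric:
  fixes \<mu> :: "'a::metric_space measure" and k :: "'a \<Rightarrow> 'a measure"
  assumes sets_mu: "sets \<mu> = sets borel" and sf: "sigma_finite_measure \<mu>"
    and k: "is_kernel k" and sum: "countable_sum_of_finite_kernels k"
    and F: "F \<in> borel_measurable (\<mu> \<Otimes>\<^sub>M \<mu>)" "\<And>p. 0 < F p" and sym: "symmetric_fun F"
  shows "info_functional (\<mu> \<Otimes>\<^sub>M \<mu>) (k \<oplus>\<^sub>k k) F
    = 2 * (\<integral>\<^sup>+x. \<integral>\<^sup>+u. \<integral>\<^sup>+y. ennreal (jump_cost (F (x, y)) (F (u, y))) \<partial>\<mu> \<partial>k x \<partial>\<mu>)"
proof -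
  interpret \<mu>: sigma_finite_measure \<mu> by fact
  interpret \<mu>\<mu>: pair_sigma_finite \<mu> \<mu> ..
  have kx [measurable_cong]: "sets (k x) = sets borel" and sfk: "sigma_finite_measure (k x)" for x
    using k by (auto simp: is_kernel_def)
  note [measurable_cong] = sets_mu
  have [simp]: "space \<mu> = UNIV" using sets_eq_imp_space_eq[OF sets_mu] by simp
  have [measurable]: "F \<in> borel_measurable (borel \<Otimes>\<^sub>M borel)"
    using F(1) by measurable
  define I where "I = (\<lambda>x y. \<integral>\<^sup>+u. ennreal (jump_cost (F (x, y)) (F (u, y))) \<partial>k x)"
  have I [measurable]: "(\<lambda>(x, y). I x y) \<in> borel_measurable (\<mu> \<Otimes>\<^sub>M \<mu>)"
  proof -
    have "(\<lambda>p. \<integral>\<^sup>+u. (\<lambda>(p, u). ennreal (jump_cost (F p) (F (u, snd p)))) (p, u) \<partial>k (fst p))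
      \<in> borel_measurable (\<mu> \<Otimes>\<^sub>M \<mu>)"
      by (rule measurable_nn_integral_kernel[OF k sum]) measurable
    then show ?thesis by (simp add: I_def split_beta')
  qed
  have Psi: "ennreal (F (x, y)) * Psi_Upsilon (k \<oplus>\<^sub>k k) (\<lambda>p. ln (F p)) (x, y) = I x y + I y x" for x y
  proof -
    have "ennreal (F (x, y)) * Psi_Upsilon (k \<oplus>\<^sub>k k) (\<lambda>p. ln (F p)) (x, y)
      = (\<integral>\<^sup>+p. ennreal (jump_cost (F (x, y)) (F p)) \<partial>(k \<oplus>\<^sub>k k) (x, y))"
      by (rule times_Psi_Upsilon_ln[where N = "borel \<Otimes>\<^sub>M borel"]) (use F in auto)
    also have "\<dots> = I x y + (\<integral>\<^sup>+v. ennreal (jump_cost (F (x, y)) (F (x, v))) \<partial>k y)"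
      unfolding I_def by (rule nn_integral_kernel_tensor[OF kx kx]) measurable
    finally show ?thesis
      using sym by (simp add: I_def symmetric_fun_def)
  qed
  have "info_functional (\<mu> \<Otimes>\<^sub>M \<mu>) (k \<oplus>\<^sub>k k) F = (\<integral>\<^sup>+p. (case p of (x, y) \<Rightarrow> I x y + I y x) \<partial>(\<mu> \<Otimes>\<^sub>M \<mu>))"
    unfolding info_functional_def by (intro nn_integral_cong) (auto simp: Psi)
  also have "\<dots> = (\<integral>\<^sup>+x. \<integral>\<^sup>+y. I x y + I y x \<partial>\<mu> \<partial>\<mu>)"
    by (subst \<mu>.nn_integral_fst[symmetric]) auto
  also have "\<dots> = (\<integral>\<^sup>+x. \<integral>\<^sup>+y. I x y \<partial>\<mu> \<partial>\<mu>) + (\<integral>\<^sup>+x. \<integral>\<^sup>+y. I y x \<partial>\<mu> \<partial>\<mu>)"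
    by (simp add: nn_integral_add)
  also have "(\<integral>\<^sup>+x. \<integral>\<^sup>+y. I y x \<partial>\<mu> \<partial>\<mu>) = (\<integral>\<^sup>+x. \<integral>\<^sup>+y. I x y \<partial>\<mu> \<partial>\<mu>)"
    by (rule \<mu>\<mu>.Fubini') measurable
  also have "(\<integral>\<^sup>+x. \<integral>\<^sup>+y. I x y \<partial>\<mu> \<partial>\<mu>)
    = (\<integral>\<^sup>+x. \<integral>\<^sup>+u. \<integral>\<^sup>+y. ennreal (jump_cost (F (x, y)) (F (u, y))) \<partial>\<mu> \<partial>k x \<partial>\<mu>)"
  proof (rule nn_integral_cong)
    fix x
    interpret kx: sigma_finite_measure "k x" by (rule sfk)
    interpret p: pair_sigma_finite "k x" \<mu> ..
    show "(\<integral>\<^sup>+y. I x y \<partial>\<mu>) = (\<integral>\<^sup>+u. \<integral>\<^sup>+y. ennreal (jump_cost (F (x, y)) (F (u, y))) \<partial>\<mu> \<partial>k x)"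
      unfolding I_def by (rule p.Fubini') measurable
  qed
  finally show ?thesis by (simp add: mult_2)
qed

section \<open>The lifting property\<close>

lemma info_functional_eq_jump_cost:
  fixes \<mu> :: "'a::metric_space measure" and k :: "'a \<Rightarrow> 'a measure"
  assumes sets_mu: "sets \<mu> = sets borel" and k: "is_kernel k"
    and f: "f \<in> borel_measurable \<mu>" "\<And>x. 0 < f x"
  shows "info_functional \<mu> k f = (\<integral>\<^sup>+x. \<integral>\<^sup>+u. ennreal (jump_cost (f x) (f u)) \<partial>k x \<partial>\<mu>)"
  unfolding info_functional_def
proof (rule nn_integral_cong)
  fix x
  show "ennreal (f x) * Psi_Upsilon k (\<lambda>y. ln (f y)) x = (\<integral>\<^sup>+u. ennreal (jump_cost (f x) (f u)) \<partial>k x)"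
    by (rule times_Psi_Upsilon_ln[where N = \<mu>]) (use f k sets_mu in \<open>auto simp: is_kernel_def\<close>)
qed

lemma info_functional_fun_tensor:
  fixes \<mu> :: "'a::metric_space measure" and k :: "'a \<Rightarrow> 'a measure"
  assumes sets_mu: "sets \<mu> = sets borel" and sf: "sigma_finite_measure \<mu>"
    and k: "is_kernel k" and sum: "countable_sum_of_finite_kernels k"
    and f: "f \<in> pos_prob_densities \<mu>"
  shows "info_functional (\<mu> \<Otimes>\<^sub>M \<mu>) (k \<oplus>\<^sub>k k) (fun_tensor f f) = 2 * info_functional \<mu> k f"
proof -
  have [simp]: "space \<mu> = UNIV" using sets_eq_imp_space_eq[OF sets_mu] by simp
  have f_meas [measurable]: "f \<in> borel_measurable \<mu>" and pos: "\<And>x. 0 < f x"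
    and one: "(\<integral>\<^sup>+x. ennreal (f x) \<partial>\<mu>) = 1"
    using f by (auto simp: pos_prob_densities_def)
  \<comment> \<open>The factor \<open>f y\<close> comes out of the jump cost by homogeneity and integrates to one.\<close>
  have inner: "(\<integral>\<^sup>+y. ennreal (jump_cost (f x * f y) (f u * f y)) \<partial>\<mu>) = ennreal (jump_cost (f x) (f u))"
    for x u
  proof -
    have "(\<integral>\<^sup>+y. ennreal (jump_cost (f x * f y) (f u * f y)) \<partial>\<mu>)
      = (\<integral>\<^sup>+y. ennreal (f y) * ennreal (jump_cost (f x) (f u)) \<partial>\<mu>)"
      using pos by (intro nn_integral_cong)
        (simp add: jump_cost_homogeneous ennreal_mult jump_cost_nonneg less_imp_le)
    then show ?thesis by (simp add: nn_integral_multc one)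
  qed
  have "info_functional (\<mu> \<Otimes>\<^sub>M \<mu>) (k \<oplus>\<^sub>k k) (fun_tensor f f)
    = 2 * (\<integral>\<^sup>+x. \<integral>\<^sup>+u. \<integral>\<^sup>+y. ennreal (jump_cost (fun_tensor f f (x, y)) (fun_tensor f f (u, y))) \<partial>\<mu> \<partial>k x \<partial>\<mu>)"
    by (rule info_functional_symmetric[OF sets_mu sf k sum])
      (use pos in \<open>auto simp: fun_tensor_def symmetric_fun_def mult.commute split_beta'\<close>)
  then show ?thesis
    by (simp add: fun_tensor_def inner info_functional_eq_jump_cost[OF sets_mu k f_meas pos])
qed

lemma info_functional_marginal_le:
  fixes \<mu> :: "'a::metric_space measure" and k :: "'a \<Rightarrow> 'a measure"
  assumes sets_mu: "sets \<mu> = sets borel" and sf: "sigma_finite_measure \<mu>"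
    and k: "is_kernel k" and sum: "countable_sum_of_finite_kernels k"
    and F: "F \<in> pos_prob_densities (\<mu> \<Otimes>\<^sub>M \<mu>)" and sym: "symmetric_fun F"
    and m: "marginal \<mu> F \<in> pos_prob_densities \<mu>"
  shows "2 * info_functional \<mu> k (marginal \<mu> F) \<le> info_functional (\<mu> \<Otimes>\<^sub>M \<mu>) (k \<oplus>\<^sub>k k) F"
proof -
  have [simp]: "space \<mu> = UNIV" using sets_eq_imp_space_eq[OF sets_mu] by simp
  have F_meas: "F \<in> borel_measurable (\<mu> \<Otimes>\<^sub>M \<mu>)" and pos: "\<And>p. 0 < F p"
    using F by (auto simp: pos_prob_densities_def space_pair_measure)
  have m_meas: "marginal \<mu> F \<in> borel_measurable \<mu>" and m_pos: "\<And>x. 0 < marginal \<mu> F x"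
    using m by (auto simp: pos_prob_densities_def)
  \<comment> \<open>A marginal value computed from a non-integrable section would be \<open>0\<close>, so strict positivity
    of the marginal gives integrability of every section, not just of almost every one.\<close>
  have int: "integrable \<mu> (\<lambda>y. F (x, y))" for x
    using m_pos[of x] not_integrable_integral_eq[of \<mu> "\<lambda>y. F (x, y)"] by (auto simp: marginal_def)
  have "info_functional \<mu> k (marginal \<mu> F)
    = (\<integral>\<^sup>+x. \<integral>\<^sup>+u. ennreal (jump_cost (marginal \<mu> F x) (marginal \<mu> F u)) \<partial>k x \<partial>\<mu>)"
    by (rule info_functional_eq_jump_cost[OF sets_mu k m_meas m_pos])
  also have "\<dots> \<le> (\<integral>\<^sup>+x. \<integral>\<^sup>+u. \<integral>\<^sup>+y. ennreal (jump_cost (F (x, y)) (F (u, y))) \<partial>\<mu> \<partial>k x \<partial>\<mu>)"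
    unfolding marginal_def
    by (intro nn_integral_mono jump_cost_Jensen int pos m_pos[unfolded marginal_def])
  finally show ?thesis
    unfolding info_functional_symmetric[OF sets_mu sf k sum F_meas pos sym]
    by (intro mult_left_mono) auto
qed

theorem theorem2p1:
  fixes \<mu> :: "'a::metric_space measure" and k :: "'a \<Rightarrow> 'a measure"
  assumes borel_prod: "sets (borel :: ('a \<times> 'a) measure) = sets (borel \<Otimes>\<^sub>M borel)"
    and sets_mu: "sets \<mu> = sets borel"
    and sigma_finite: "sigma_finite_measure \<mu>"
    and kernel: "is_kernel k"
    and sum_finite: "countable_sum_of_finite_kernels k"
  shows "is_lifting \<mu>
           (pos_prob_densities (\<mu> \<Otimes>\<^sub>M \<mu>)) (info_functional (\<mu> \<Otimes>\<^sub>M \<mu>) (k \<oplus>\<^sub>k k))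
           (pos_prob_densities \<mu>) (info_functional \<mu> k)"
  unfolding is_lifting_def
proof (intro conjI ballI impI)
  show "pos_prob_densities \<mu> \<subseteq> prob_densities \<mu>"
    "pos_prob_densities (\<mu> \<Otimes>\<^sub>M \<mu>) \<subseteq> prob_densities (\<mu> \<Otimes>\<^sub>M \<mu>)"
    by (auto simp: pos_prob_densities_def prob_densities_def less_imp_le)
next
  fix f
  assume "f \<in> pos_prob_densities \<mu>"
  then show "info_functional (\<mu> \<Otimes>\<^sub>M \<mu>) (k \<oplus>\<^sub>k k) (fun_tensor f f) = 2 * info_functional \<mu> k f"
    by (rule info_functional_fun_tensor[OF sets_mu sigma_finite kernel sum_finite])
next
  fix F
  assume "F \<in> pos_prob_densities (\<mu> \<Otimes>\<^sub>M \<mu>)" "symmetric_fun F" "marginal \<mu> F \<in> pos_prob_densities \<mu>"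
  then show "2 * info_functional \<mu> k (marginal \<mu> F) \<le> info_functional (\<mu> \<Otimes>\<^sub>M \<mu>) (k \<oplus>\<^sub>k k) F"
    by (rule info_functional_marginal_le[OF sets_mu sigma_finite kernel sum_finite])
qed

end
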